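(* Let $\Lambda\subset\mathbb{Z}^2$ be finite. For all $\beta>0$ and $i\in\Lambda$, there exists a constant $C\le16$ such that $$\mu^e_{\Lambda;\beta}\big(\{\omega\in\Omega^e_\Lambda: i\in\mathcal{E}(\omega)\}\big)\le C e^{-2\beta}.$$
   Context: $\mathbb{Z}^2$ is the square grid graph, $i\sim j$ iff $\|i-j\|_1=1$; $\Omega=\{0,1\}^{\mathbb{Z}^2}$. A configuration $\omega$ satisfies the recovery rule at $i$ if ($\omega_i=1$ if and only if $\omega_j=0$ for all four $j\sim i$); $\mathcal{E}(\omega)$ is the set of sites where $\omega$ violates the rule. $\omega^e$ is the configuration with $\omega^e_i=1$ iff $i_1+i_2$ is even. $\Omega^e_\Lambda=\{\omega\in\Omega:\omega_{\Lambda^c}=\omega^e_{\Lambda^c}\}$; $\partial\Lambda$ is the set of sites outside $\Lambda$ with a neighbor in $\Lambda$; $\Lambda^+=\Lambda\cup\partial\Lambda$. The Gibbs distribution with even boundary condition is the probability measure on $\Omega^e_\Lambda$ given by $$\mu^e_{\Lambda;\beta}(\omega)=\frac{e^{-2\beta|\mathcal{E}(\omega)\cap\Lambda^+|}}{\sum_{\omega'\in\Omega^e_\Lambda}e^{-2\beta|\mathcal{E}(\omega')\cap\Lambda^+|}}.$$ *)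

theory Defs
  imports "HOL-Probability.Probability"
begin

type_synonym site = "int \<times> int"

text \<open>A \<open>{0,1}\<close>-valued function on the grid is encoded as a predicate:
  \<open>\<omega> i\<close> stands for the value 1 at \<open>i\<close>, and \<open>\<not> \<omega> i\<close> for the value 0.
  In particular \<open>\<Omega>\<close> is the whole type \<open>config\<close>.\<close>

type_synonym config = "site \<Rightarrow> bool"

definition adj :: "site \<Rightarrow> site \<Rightarrow> bool"  (infix \<open>\<approx>\<close> 50) where
  "i \<approx> j \<longleftrightarrow> \<bar>fst i - fst j\<bar> + \<bar>snd i - snd j\<bar> = 1"

definition recovery_rule :: "config \<Rightarrow> site \<Rightarrow> bool" where
  "recovery_rule \<omega> i \<longleftrightarrow> (\<omega> i \<longleftrightarrow> (\<forall>j. j \<approx> i \<longrightarrow> \<not> \<omega> j))"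

definition errors :: "config \<Rightarrow> site set"  (\<open>\<E>\<close>) where
  "\<E> \<omega> = {i. \<not> recovery_rule \<omega> i}"

definition even_config :: config where
  "even_config i \<longleftrightarrow> even (fst i + snd i)"

definition even_configs :: "site set \<Rightarrow> config set"  (\<open>\<Omega>e\<close>) where
  "\<Omega>e \<Lambda> = {\<omega>. \<forall>i\<in>- \<Lambda>. \<omega> i = even_config i}"

definition outer_boundary :: "site set \<Rightarrow> site set" where
  "outer_boundary \<Lambda> = {i. i \<notin> \<Lambda> \<and> (\<exists>j\<in>\<Lambda>. i \<approx> j)}"

definition enlargement :: "site set \<Rightarrow> site set" where
  "enlargement \<Lambda> = \<Lambda> \<union> outer_boundary \<Lambda>"

definition gibbs_weight :: "site set \<Rightarrow> real \<Rightarrow> config \<Rightarrow> real" where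
  "gibbs_weight \<Lambda> \<beta> \<omega> = exp (- 2 * \<beta> * real (card (\<E> \<omega> \<inter> enlargement \<Lambda>)))"

definition gibbs_even :: "site set \<Rightarrow> real \<Rightarrow> config measure" where
  "gibbs_even \<Lambda> \<beta> = point_measure (\<Omega>e \<Lambda>)
     (\<lambda>\<omega>. ennreal (gibbs_weight \<Lambda> \<beta> \<omega> / (\<Sum>\<omega>'\<in>\<Omega>e \<Lambda>. gibbs_weight \<Lambda> \<beta> \<omega>')))"

text \<open>For finite \<open>\<Lambda>\<close>, the cardinalities and sums above range over finite sets,
  and \<open>gibbs_even\<close> is a probability measure.\<close>

lemma finite_enlargement:
  assumes "finite \<Lambda>"
  shows "finite (enlargement \<Lambda>)"
proof -
  have "outer_boundary \<Lambda> \<subseteq> (\<Union>j\<in>\<Lambda>. {fst j - 1..fst j + 1} \<times> {snd j - 1..snd j + 1})"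
  proof
    fix i assume "i \<in> outer_boundary \<Lambda>"
    then obtain j where "j \<in> \<Lambda>" "\<bar>fst i - fst j\<bar> + \<bar>snd i - snd j\<bar> = 1"
      by (auto simp: outer_boundary_def adj_def)
    moreover from this(2) have "i \<in> {fst j - 1..fst j + 1} \<times> {snd j - 1..snd j + 1}"
      unfolding mem_Times_iff atLeastAtMost_iff by linarith
    ultimately show "i \<in> (\<Union>j\<in>\<Lambda>. {fst j - 1..fst j + 1} \<times> {snd j - 1..snd j + 1})"
      by blast
  qed
  then have "finite (outer_boundary \<Lambda>)"
    by (rule finite_subset) (use assms in auto)
  with assms show ?thesis
    by (simp add: enlargement_def)
qed

lemma even_config_in: "even_config \<in> \<Omega>e \<Lambda>"
  by (simp add: even_configs_def)

lemma finite_even_configs: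
  assumes "finite \<Lambda>"
  shows "finite (\<Omega>e \<Lambda>)"
proof -
  have "\<Omega>e \<Lambda> \<subseteq> (\<lambda>A i. if i \<in> \<Lambda> then i \<in> A else even_config i) ` Pow \<Lambda>"
  proof
    fix \<omega> assume "\<omega> \<in> \<Omega>e \<Lambda>"
    then have "\<omega> = (\<lambda>i. if i \<in> \<Lambda> then i \<in> {i\<in>\<Lambda>. \<omega> i} else even_config i)"
      by (auto simp: even_configs_def)
    then show "\<omega> \<in> (\<lambda>A i. if i \<in> \<Lambda> then i \<in> A else even_config i) ` Pow \<Lambda>"
      by blast
  qed
  then show ?thesis
    by (rule finite_subset) (use assms in simp)
qed

lemma partition_function_pos:
  assumes "finite \<Lambda>"
  shows "0 < (\<Sum>\<omega>\<in>\<Omega>e \<Lambda>. gibbs_weight \<Lambda> \<beta> \<omega>)"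
proof (rule sum_pos)
  show "\<Omega>e \<Lambda> \<noteq> {}"
    using even_config_in by blast
qed (simp_all add: finite_even_configs assms gibbs_weight_def)

lemma prob_space_gibbs_even:
  assumes "finite \<Lambda>"
  shows "prob_space (gibbs_even \<Lambda> \<beta>)"
proof (rule prob_spaceI)
  have "0 \<le> gibbs_weight \<Lambda> \<beta> \<omega>" for \<omega>
    by (simp add: gibbs_weight_def)
  with partition_function_pos[OF assms, of \<beta>]
  show "emeasure (gibbs_even \<Lambda> \<beta>) (space (gibbs_even \<Lambda> \<beta>)) = 1"
    by (simp add: gibbs_even_def space_point_measure
        emeasure_point_measure_finite[OF finite_even_configs[OF assms]]
        flip: sum_divide_distrib)
qed

lemma measure_gibbs_even:
  assumes "finite \<Lambda>" and "A \<subseteq> \<Omega>e \<Lambda>"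
  shows "measure (gibbs_even \<Lambda> \<beta>) A =
    (\<Sum>\<omega>\<in>A. gibbs_weight \<Lambda> \<beta> \<omega>) / (\<Sum>\<omega>\<in>\<Omega>e \<Lambda>. gibbs_weight \<Lambda> \<beta> \<omega>)"
proof -
  have "0 \<le> gibbs_weight \<Lambda> \<beta> \<omega>" for \<omega>
    by (simp add: gibbs_weight_def)
  with assms partition_function_pos[OF assms(1), of \<beta>] show ?thesis
    by (simp add: gibbs_even_def measure_point_measure_finite_if finite_even_configs
        sum_divide_distrib)
qed

end

theory Submission
  imports Defs
begin

text \<open>The proof is a Peierls-type argument: a configuration with an error at \<open>i\<close> is mapped to
  one with fewer errors, and the number of preimages is compared with the weight gained. Put
  \<open>x = exp (- 2 * \<beta>)\<close>, the cost of one error.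

  There are two kinds of error. At a \<^emph>\<open>vacant\<close> error the site and its four neighbours are all 0.
  Occupying the site removes this error and creates none
  (\<open>errors_occupy_vacant\<close>), and the map is injective, so vacant errors at \<open>i\<close>
  have probability at most \<open>x\<close>.

  At a \<^emph>\<open>crowded\<close> error the site and one of its neighbours are both 1. Emptying
  a crowded site can leave some of its neighbours with no occupied neighbour; these have
  to be occupied in turn, which is possible only if they lie in \<open>\<Lambda>\<close>. The even
  boundary condition ensures this when the emptied sites are odd: the neighbours to be
  occupied are then even sites with value 0, and all even sites outside \<open>\<Lambda>\<close> have value 1. This
  repair of a set \<open>K\<close> of crowded odd sites removes all errors in \<open>K\<close> and creates none
  (\<open>errors_repair\<close>), and it can be undone if one knows \<open>K\<close> and the set of newly occupied sites.

  If \<open>i\<close> is odd, take \<open>K = {i}\<close>. The newly occupied sites form a proper subset of the neighbours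
  of \<open>i\<close>, so there are at most 15 preimages, and the probability is at most \<open>15 * x\<close>.
  If \<open>i\<close> is even, take for \<open>K\<close> the nonempty set of occupied neighbours of \<open>i\<close>. The error at \<open>i\<close>
  disappears together with those in \<open>K\<close>, which gains a factor \<open>x ^ (card K + 1)\<close>. Each site
  of \<open>K\<close> has three neighbours other than \<open>i\<close>, so at most \<open>8 ^ card K\<close> sets can be
  newly occupied. If \<open>8 * x \<le> 1\<close>, each of the 15 possible \<open>K\<close> thus contributes at most
  \<open>x\<close>. In the opposite case \<open>16 * x > 1\<close> and there is nothing to prove.\<close>

section \<open>The grid\<close>

declare split_paired_All [simp del] split_paired_Ex [simp del]
no_notation eqpoll (infixl \<open>\<approx>\<close> 50)

abbreviation neighbors :: "site \<Rightarrow> site set" where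
  "neighbors i \<equiv> {j. j \<approx> i}"

lemma adj_commute: "i \<approx> j \<longleftrightarrow> j \<approx> i"
  by (auto simp: adj_def)

lemma neighbors_eq:
  "neighbors i = {(fst i + 1, snd i), (fst i - 1, snd i), (fst i, snd i + 1), (fst i, snd i - 1)}"
proof -
  have "\<bar>a\<bar> + \<bar>b\<bar> = 1 \<longleftrightarrow>
    a = 1 \<and> b = 0 \<or> a = - 1 \<and> b = 0 \<or> a = 0 \<and> b = 1 \<or> a = 0 \<and> b = - 1" for a b :: int
    by arith
  then show ?thesis
    unfolding adj_def by (intro set_eqI) (simp add: prod_eq_iff, linarith)
qed

lemma adj_parity:
  assumes "i \<approx> j"
  shows "even_config i \<longleftrightarrow> \<not> even_config j"
proof -
  have "i \<in> neighbors j" using assms by simp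
  then show ?thesis
    unfolding neighbors_eq by (auto simp: even_config_def)
qed

lemma finite_neighbors: "finite (neighbors i)"
  by (simp add: neighbors_eq)

lemma card_neighbors: "card (neighbors i) = 4"
  by (simp add: neighbors_eq)

section \<open>Comparing weights\<close>

lemma gibbs_weight_eq_power:
  "gibbs_weight \<Lambda> \<beta> \<omega> = exp (- 2 * \<beta>) ^ card (\<E> \<omega> \<inter> enlargement \<Lambda>)"
  unfolding gibbs_weight_def exp_of_nat2_mult ..

lemma gibbs_weight_le_if_errors_removed:
  assumes "finite \<Lambda>" "\<beta> > 0" "D \<subseteq> \<Lambda>" "D \<subseteq> \<E> \<omega>" "\<E> \<omega>' \<subseteq> \<E> \<omega> - D"
  shows "gibbs_weight \<Lambda> \<beta> \<omega> \<le> exp (- 2 * \<beta>) ^ card D * gibbs_weight \<Lambda> \<beta> \<omega>'"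
proof -
  have fin: "finite (\<E> \<omega> \<inter> enlargement \<Lambda>)" "finite (\<E> \<omega>' \<inter> enlargement \<Lambda>)" "finite D"
    using finite_enlargement[OF assms(1)] finite_subset[OF assms(3,1)] by auto
  have "card D + card (\<E> \<omega>' \<inter> enlargement \<Lambda>) = card (D \<union> \<E> \<omega>' \<inter> enlargement \<Lambda>)"
    using assms(5) fin by (intro card_Un_disjoint[symmetric]) auto
  also have "\<dots> \<le> card (\<E> \<omega> \<inter> enlargement \<Lambda>)"
    using assms(3-5) fin by (intro card_mono) (auto simp: enlargement_def)
  finally show ?thesis
    using assms(2) unfolding gibbs_weight_eq_power power_add[symmetric]
    by (intro power_decreasing) auto
qed

text \<open>The counting principle behind the three estimates: \<open>r\<close> removes errors, and the label \<open>F \<omega>\<close> records what is needed to recover \<open>\<omega>\<close> from \<open>r \<omega>\<close>, so that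
  \<open>r\<close> is at most \<open>card \<S>\<close>-to-one.\<close>

lemma sum_gibbs_weight_le:
  assumes "finite \<Lambda>" "finite \<S>"
    and "\<And>\<omega>. \<omega> \<in> A \<Longrightarrow> r \<omega> \<in> \<Omega>e \<Lambda>" "\<And>\<omega>. \<omega> \<in> A \<Longrightarrow> F \<omega> \<in> \<S>"
    and inj: "inj_on (\<lambda>\<omega>. (r \<omega>, F \<omega>)) A"
    and weight: "\<And>\<omega>. \<omega> \<in> A \<Longrightarrow> gibbs_weight \<Lambda> \<beta> \<omega> \<le> c * gibbs_weight \<Lambda> \<beta> (r \<omega>)"
    and "c \<ge> 0"
  shows "(\<Sum>\<omega>\<in>A. gibbs_weight \<Lambda> \<beta> \<omega>) \<le> real (card \<S>) * c * (\<Sum>\<omega>\<in>\<Omega>e \<Lambda>. gibbs_weight \<Lambda> \<beta> \<omega>)"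
proof -
  let ?w = "gibbs_weight \<Lambda> \<beta>"
  have "(\<Sum>\<omega>\<in>A. ?w \<omega>) \<le> (\<Sum>\<omega>\<in>A. c * ?w (r \<omega>))"
    by (intro sum_mono weight)
  also have "\<dots> = (\<Sum>p\<in>(\<lambda>\<omega>. (r \<omega>, F \<omega>)) ` A. c * ?w (fst p))"
    by (simp add: sum.reindex[OF inj])
  also have "\<dots> \<le> (\<Sum>p\<in>\<Omega>e \<Lambda> \<times> \<S>. c * ?w (fst p))"
  proof (rule sum_mono2)
    show "finite (\<Omega>e \<Lambda> \<times> \<S>)"
      using assms(1,2) finite_even_configs by blast
    show "(\<lambda>\<omega>. (r \<omega>, F \<omega>)) ` A \<subseteq> \<Omega>e \<Lambda> \<times> \<S>"
      using assms(3,4) by blast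
  qed (use \<open>c \<ge> 0\<close> in \<open>simp add: gibbs_weight_def\<close>)
  also have "\<dots> = (\<Sum>\<omega>\<in>\<Omega>e \<Lambda>. \<Sum>s\<in>\<S>. c * ?w \<omega>)"
    unfolding sum.cartesian_product by (simp add: case_prod_unfold)
  also have "\<dots> = real (card \<S>) * c * (\<Sum>\<omega>\<in>\<Omega>e \<Lambda>. ?w \<omega>)"
    by (simp add: sum_distrib_left mult.assoc)
  finally show ?thesis .
qed

section \<open>Vacant errors\<close>

definition vacant :: "config \<Rightarrow> site \<Rightarrow> bool" where
  "vacant \<omega> i \<longleftrightarrow> \<not> \<omega> i \<and> (\<forall>j. j \<approx> i \<longrightarrow> \<not> \<omega> j)"

definition crowded :: "config \<Rightarrow> site \<Rightarrow> bool" where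
  "crowded \<omega> i \<longleftrightarrow> \<omega> i \<and> (\<exists>j. j \<approx> i \<and> \<omega> j)"

lemma errors_iff: "i \<in> \<E> \<omega> \<longleftrightarrow> vacant \<omega> i \<or> crowded \<omega> i"
  by (auto simp: errors_def recovery_rule_def vacant_def crowded_def)

text \<open>Besides \<open>i\<close> itself, only the neighbours of \<open>i\<close> see the change, and they obey the rule
  afterwards because they are 0 and have the occupied neighbour \<open>i\<close>.\<close>

lemma errors_occupy_vacant:
  assumes "vacant \<omega> i"
  shows "\<E> (\<omega> (i := True)) \<subseteq> \<E> \<omega> - {i}"
proof
  let ?\<omega>' = "\<omega> (i := True)"
  have occ: "?\<omega>' j \<longleftrightarrow> \<omega> j \<or> j = i" for j by simp
  have irrefl: "\<not> i \<approx> i" by (simp add: adj_def)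
  have \<omega>: "\<not> \<omega> i" "\<And>j. j \<approx> i \<Longrightarrow> \<not> \<omega> j"
    using assms by (simp_all add: vacant_def)
  fix j assume j: "j \<in> \<E> ?\<omega>'"
  then have j': "\<not> (\<omega> j \<or> j = i) \<and> (\<forall>l. l \<approx> j \<longrightarrow> \<not> (\<omega> l \<or> l = i)) \<or>
      (\<omega> j \<or> j = i) \<and> (\<exists>l. l \<approx> j \<and> (\<omega> l \<or> l = i))"
    unfolding errors_iff vacant_def crowded_def occ .
  then have "j \<noteq> i" using irrefl \<omega> by blast
  moreover have "\<not> i \<approx> j"
  proof
    assume "i \<approx> j"
    then have "\<not> \<omega> j" using \<omega>(2) adj_commute[of i j] by simp
    with j' \<open>j \<noteq> i\<close> \<open>i \<approx> j\<close> show False by blast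
  qed
  ultimately show "j \<in> \<E> \<omega> - {i}"
    using j' unfolding Diff_iff errors_iff vacant_def crowded_def by blast
qed

lemma sum_gibbs_weight_vacant_le:
  assumes "finite \<Lambda>" "\<beta> > 0" "i \<in> \<Lambda>"
  shows "(\<Sum>\<omega> | \<omega> \<in> \<Omega>e \<Lambda> \<and> vacant \<omega> i. gibbs_weight \<Lambda> \<beta> \<omega>)
    \<le> exp (- 2 * \<beta>) * (\<Sum>\<omega>\<in>\<Omega>e \<Lambda>. gibbs_weight \<Lambda> \<beta> \<omega>)"
proof -
  let ?A = "{\<omega>. \<omega> \<in> \<Omega>e \<Lambda> \<and> vacant \<omega> i}"
  have "inj_on (\<lambda>\<omega>. (\<omega> (i := True), ())) ?A"
  proof (rule inj_onI, rule ext)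
    fix \<omega> \<omega>' j
    assume \<omega>: "\<omega> \<in> ?A" "\<omega>' \<in> ?A" and "(\<omega> (i := True), ()) = (\<omega>' (i := True), ())"
    then have "(\<omega> (i := True)) j = (\<omega>' (i := True)) j"
      by (simp only: prod.inject)
    then show "\<omega> j = \<omega>' j"
      using \<omega> by (cases "j = i") (simp_all add: vacant_def)
  qed
  moreover have "gibbs_weight \<Lambda> \<beta> \<omega> \<le> exp (- 2 * \<beta>) * gibbs_weight \<Lambda> \<beta> (\<omega> (i := True))"
    if "\<omega> \<in> ?A" for \<omega>
    using gibbs_weight_le_if_errors_removed[of \<Lambda> \<beta> "{i}" \<omega> "\<omega> (i := True)"] assms that
      errors_occupy_vacant[of \<omega> i] by (simp add: errors_iff)
  ultimately show ?thesis
    using sum_gibbs_weight_le[of \<Lambda> "{()}" ?A "\<lambda>\<omega>. \<omega> (i := True)" "\<lambda>_. ()" \<beta> "exp (- 2 * \<beta>)"] assms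
    by (auto simp: even_configs_def)
qed

section \<open>Repairing crowded odd sites\<close>

text \<open>If \<open>K\<close> consists of crowded odd sites, these are the vacant errors created by emptying \<open>K\<close>.\<close>

definition vacated :: "site set \<Rightarrow> config \<Rightarrow> site set" where
  "vacated K \<omega> = {j. (\<exists>k\<in>K. j \<approx> k) \<and> \<not> \<omega> j \<and> (\<forall>l. l \<approx> j \<and> \<omega> l \<longrightarrow> l \<in> K)}"

definition repair :: "site set \<Rightarrow> config \<Rightarrow> config" where
  "repair K \<omega> j \<longleftrightarrow> \<omega> j \<and> j \<notin> K \<or> j \<in> vacated K \<omega>"

definition crowded_odd :: "site set \<Rightarrow> config \<Rightarrow> bool" where
  "crowded_odd K \<omega> \<longleftrightarrow> (\<forall>k\<in>K. crowded \<omega> k \<and> \<not> even_config k)"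

lemma vacated_even: "crowded_odd K \<omega> \<Longrightarrow> j \<in> vacated K \<omega> \<Longrightarrow> even_config j"
  unfolding crowded_odd_def vacated_def using adj_parity by blast

text \<open>Since \<open>K\<close> is odd and the vacated sites are even, no two vacated sites are adjacent, so
  occupying all of them is safe; and every \<open>k \<in> K\<close> keeps the even neighbour
  that made it crowded, so being empty is correct for it.\<close>

lemma errors_repair:
  assumes "crowded_odd K \<omega>"
  shows "\<E> (repair K \<omega>) \<subseteq> \<E> \<omega> - K"
proof
  fix j assume j: "j \<in> \<E> (repair K \<omega>)"
  have oddK: "\<not> even_config k" "\<omega> k" "\<exists>l. l \<approx> k \<and> \<omega> l" if "k \<in> K" for k
    using assms that by (auto simp: crowded_odd_def crowded_def)
  show "j \<in> \<E> \<omega> - K"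
  proof (cases "even_config j")
    case False
    then have rj: "repair K \<omega> j \<longleftrightarrow> \<omega> j \<and> j \<notin> K"
      unfolding repair_def using vacated_even[OF assms] by blast
    have rl: "repair K \<omega> l \<longleftrightarrow> \<omega> l \<or> l \<in> vacated K \<omega>" if "l \<approx> j" for l
      unfolding repair_def using that False oddK(1) adj_parity by blast
    have "j \<notin> K"
    proof
      assume "j \<in> K"
      with oddK(3) rl have "\<exists>l. l \<approx> j \<and> repair K \<omega> l" by blast
      with \<open>j \<in> K\<close> rj j show False by (auto simp: errors_iff vacant_def crowded_def)
    qed
    moreover have "l \<notin> vacated K \<omega>" if "l \<approx> j" for l
    proof
      assume l: "l \<in> vacated K \<omega>"
      then have "\<not> \<omega> j"
        using that \<open>j \<notin> K\<close> adj_commute unfolding vacated_def by blast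
      with rj rl[OF that] l that j show False by (auto simp: errors_iff vacant_def crowded_def)
    qed
    ultimately show ?thesis
      using j rj rl by (auto simp: errors_iff vacant_def crowded_def)
  next
    case True
    then have "j \<notin> K" using oddK(1) by blast
    have rl: "repair K \<omega> l \<longleftrightarrow> \<omega> l \<and> l \<notin> K" if "l \<approx> j" for l
      unfolding repair_def using that True vacated_even[OF assms] adj_parity by blast
    have "j \<notin> vacated K \<omega>"
    proof
      assume v: "j \<in> vacated K \<omega>"
      then have "repair K \<omega> j" "\<not> repair K \<omega> l" if "l \<approx> j" for l
        using rl[OF that] that by (auto simp: repair_def vacated_def)
      moreover have "repair K \<omega> j" using v by (simp add: repair_def)
      ultimately show False using j by (auto simp: errors_iff vacant_def crowded_def)
    qed
    then have rj: "repair K \<omega> j \<longleftrightarrow> \<omega> j"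
      using \<open>j \<notin> K\<close> by (simp add: repair_def)
    have "j \<in> \<E> \<omega>"
    proof (cases "\<omega> j")
      case True
      then show ?thesis using j rj rl by (auto simp: errors_iff vacant_def crowded_def)
    next
      case False
      then have *: "\<And>l. l \<approx> j \<Longrightarrow> \<omega> l \<Longrightarrow> l \<in> K"
        using j rj rl by (auto simp: errors_iff vacant_def crowded_def)
      then have "\<not> (\<exists>k\<in>K. j \<approx> k)"
        using False \<open>j \<notin> vacated K \<omega>\<close> by (auto simp: vacated_def)
      then have "\<And>l. l \<approx> j \<Longrightarrow> \<not> \<omega> l"
        using * adj_commute by blast
      then show ?thesis using False by (simp add: errors_iff vacant_def)
    qed
    with \<open>j \<notin> K\<close> show ?thesis by blast
  qed
qed

lemma repair_in_even_configs:
  assumes "crowded_odd K \<omega>" "\<omega> \<in> \<Omega>e \<Lambda>"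
  shows "repair K \<omega> \<in> \<Omega>e \<Lambda>"
proof -
  have "repair K \<omega> j = even_config j" if "j \<notin> \<Lambda>" for j
  proof -
    have "\<omega> j = even_config j" using that assms(2) by (auto simp: even_configs_def)
    moreover have "j \<in> K \<Longrightarrow> \<omega> j \<and> \<not> even_config j"
      using assms(1) by (auto simp: crowded_odd_def crowded_def)
    moreover have "j \<in> vacated K \<omega> \<Longrightarrow> \<not> \<omega> j \<and> even_config j"
      using vacated_even[OF assms(1)] by (auto simp: vacated_def)
    ultimately show ?thesis by (auto simp: repair_def)
  qed
  then show ?thesis by (auto simp: even_configs_def)
qed

lemma crowded_odd_subset:
  assumes "crowded_odd K \<omega>" "\<omega> \<in> \<Omega>e \<Lambda>"
  shows "K \<subseteq> \<Lambda>"
  using assms by (auto simp: crowded_odd_def crowded_def even_configs_def)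

text \<open>Before the repair, \<open>K\<close> was occupied and the vacated sites were empty; all other sites are
  unchanged.\<close>

lemma repair_undo:
  assumes "crowded_odd K \<omega>"
  shows "\<omega> j \<longleftrightarrow> (repair K \<omega> j \<or> j \<in> K) \<and> j \<notin> vacated K \<omega>"
  using assms by (auto simp: repair_def vacated_def crowded_odd_def crowded_def)

lemma sum_gibbs_weight_repair_le:
  assumes "finite \<Lambda>" "\<beta> > 0" "finite \<S>" "A \<subseteq> \<Omega>e \<Lambda>"
    and K: "\<And>\<omega>. \<omega> \<in> A \<Longrightarrow> crowded_odd K \<omega>"
    and \<S>: "\<And>\<omega>. \<omega> \<in> A \<Longrightarrow> vacated K \<omega> \<in> \<S>"
    and D: "D \<subseteq> \<Lambda>" "\<And>\<omega>. \<omega> \<in> A \<Longrightarrow> D \<subseteq> \<E> \<omega>" "\<And>\<omega>. \<omega> \<in> A \<Longrightarrow> D \<inter> \<E> (repair K \<omega>) = {}"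
  shows "(\<Sum>\<omega>\<in>A. gibbs_weight \<Lambda> \<beta> \<omega>)
    \<le> real (card \<S>) * exp (- 2 * \<beta>) ^ card D * (\<Sum>\<omega>\<in>\<Omega>e \<Lambda>. gibbs_weight \<Lambda> \<beta> \<omega>)"
proof (rule sum_gibbs_weight_le)
  show "inj_on (\<lambda>\<omega>. (repair K \<omega>, vacated K \<omega>)) A"
  proof (rule inj_onI, rule ext)
    fix \<omega> \<omega>' j
    assume "\<omega> \<in> A" "\<omega>' \<in> A" "(repair K \<omega>, vacated K \<omega>) = (repair K \<omega>', vacated K \<omega>')"
    then show "\<omega> j = \<omega>' j"
      using repair_undo[OF K, of \<omega> j] repair_undo[OF K, of \<omega>' j] by simp
  qed
  show "gibbs_weight \<Lambda> \<beta> \<omega> \<le> exp (- 2 * \<beta>) ^ card D * gibbs_weight \<Lambda> \<beta> (repair K \<omega>)"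
    if "\<omega> \<in> A" for \<omega>
    using assms(1,2) D(1) D(2,3)[OF that] errors_repair[OF K[OF that]]
    by (intro gibbs_weight_le_if_errors_removed) auto
qed (use assms repair_in_even_configs in auto)

section \<open>Crowded errors\<close>

text \<open>The neighbour that makes \<open>i\<close> crowded is occupied, hence not vacated; this
  excludes one of the 16 sets of neighbours and leaves room for the vacant errors at \<open>i\<close>.\<close>

lemma sum_gibbs_weight_crowded_odd_le:
  assumes "finite \<Lambda>" "\<beta> > 0" "i \<in> \<Lambda>" "\<not> even_config i"
  shows "(\<Sum>\<omega> | \<omega> \<in> \<Omega>e \<Lambda> \<and> crowded \<omega> i. gibbs_weight \<Lambda> \<beta> \<omega>)
    \<le> 15 * exp (- 2 * \<beta>) * (\<Sum>\<omega>\<in>\<Omega>e \<Lambda>. gibbs_weight \<Lambda> \<beta> \<omega>)"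
proof -
  let ?A = "{\<omega>. \<omega> \<in> \<Omega>e \<Lambda> \<and> crowded \<omega> i}" and ?S = "Pow (neighbors i) - {neighbors i}"
  have K: "crowded_odd {i} \<omega>" if "\<omega> \<in> ?A" for \<omega>
    using that assms(4) by (simp add: crowded_odd_def)
  have S: "vacated {i} \<omega> \<in> ?S" if "\<omega> \<in> ?A" for \<omega>
    using that by (auto simp: crowded_def vacated_def)
  have "(\<Sum>\<omega>\<in>?A. gibbs_weight \<Lambda> \<beta> \<omega>)
      \<le> real (card ?S) * exp (- 2 * \<beta>) ^ card {i} * (\<Sum>\<omega>\<in>\<Omega>e \<Lambda>. gibbs_weight \<Lambda> \<beta> \<omega>)"
  proof (intro sum_gibbs_weight_repair_le)
    show "finite ?S" by (simp add: finite_neighbors)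
    show "{i} \<inter> \<E> (repair {i} \<omega>) = {}" if "\<omega> \<in> ?A" for \<omega>
      using errors_repair[OF K[OF that]] by blast
  qed (use assms K S in \<open>auto simp: errors_iff\<close>)
  moreover have "card ?S = 15"
    by (simp add: finite_neighbors card_Pow card_neighbors)
  ultimately show ?thesis by simp
qed

text \<open>Emptying all occupied neighbours of \<open>i\<close> removes the error at \<open>i\<close> as well. The factors gained
  at the sites of \<open>K\<close> pay for the choice of the vacated set, at most 8 possibilities per site, and
  the factor gained at \<open>i\<close> remains.\<close>

lemma sum_gibbs_weight_occupied_neighbors_le:
  assumes "finite \<Lambda>" "\<beta> > 0" "i \<in> \<Lambda>" "even_config i" "K \<subseteq> neighbors i" "K \<noteq> {}"
    and small: "8 * exp (- 2 * \<beta>) \<le> 1"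
  shows "(\<Sum>\<omega> | \<omega> \<in> \<Omega>e \<Lambda> \<and> \<omega> i \<and> {j. j \<approx> i \<and> \<omega> j} = K. gibbs_weight \<Lambda> \<beta> \<omega>)
    \<le> exp (- 2 * \<beta>) * (\<Sum>\<omega>\<in>\<Omega>e \<Lambda>. gibbs_weight \<Lambda> \<beta> \<omega>)"
proof -
  let ?A = "{\<omega>. \<omega> \<in> \<Omega>e \<Lambda> \<and> \<omega> i \<and> {j. j \<approx> i \<and> \<omega> j} = K}"
  let ?B = "\<Union>k\<in>K. neighbors k - {i}" and ?Z = "\<Sum>\<omega>\<in>\<Omega>e \<Lambda>. gibbs_weight \<Lambda> \<beta> \<omega>"
  let ?x = "exp (- 2 * \<beta>)"
  have "i \<notin> K" using assms(5) by (auto simp: adj_def)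
  have finK: "finite K" using assms(5) finite_neighbors finite_subset by blast
  have finB: "finite ?B" using finK finite_neighbors by blast
  have Ki: "k \<approx> i" "i \<approx> k" if "k \<in> K" for k
    using that assms(5) adj_commute by blast+
  have "card ?B \<le> (\<Sum>k\<in>K. card (neighbors k - {i}))"
    by (rule card_UN_le[OF finK])
  also have "\<dots> = 3 * card K"
    using Ki(2) by (simp add: card_neighbors finite_neighbors)
  finally have cardB: "card ?B \<le> 3 * card K" .
  have K: "crowded_odd K \<omega>" if "\<omega> \<in> ?A" for \<omega>
    unfolding crowded_odd_def crowded_def using that Ki assms(4) adj_parity by blast
  have "(\<Sum>\<omega>\<in>?A. gibbs_weight \<Lambda> \<beta> \<omega>) \<le> real (card (Pow ?B)) * ?x ^ card (insert i K) * ?Z"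
  \<comment> \<open>A configuration in the sum is needed to know that \<open>K \<subseteq> \<Lambda>\<close>.\<close>
  proof (cases "?A = {}")
    case True
    show ?thesis
      unfolding True using partition_function_pos[OF assms(1), of \<beta>] by simp
  next
    case False
    show ?thesis
    proof (rule sum_gibbs_weight_repair_le)
      show "insert i K \<subseteq> \<Lambda>"
        using False crowded_odd_subset[OF K] assms(3) by auto
      fix \<omega> assume \<omega>: "\<omega> \<in> ?A"
      show "vacated K \<omega> \<in> Pow ?B"
        using \<omega> by (auto simp: vacated_def)
      show "insert i K \<subseteq> \<E> \<omega>"
        using K[OF \<omega>] \<omega> assms(6) by (auto simp: errors_iff crowded_odd_def crowded_def)
      have "repair K \<omega> i"
        using \<omega> \<open>i \<notin> K\<close> by (auto simp: repair_def)
      moreover have "\<not> repair K \<omega> j" if "j \<approx> i" for j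
        unfolding repair_def using \<omega> that vacated_even[OF K[OF \<omega>]] assms(4) adj_parity by blast
      ultimately have "i \<notin> \<E> (repair K \<omega>)"
        by (auto simp: errors_iff vacant_def crowded_def)
      then show "insert i K \<inter> \<E> (repair K \<omega>) = {}"
        using errors_repair[OF K[OF \<omega>]] by blast
    qed (use assms finB K in auto)
  qed
  also have "\<dots> \<le> ?x * ?Z"
  proof (rule mult_right_mono)
    have "real (card (Pow ?B)) = 2 ^ card ?B"
      using finB by (simp add: card_Pow)
    also have "\<dots> \<le> 2 ^ (3 * card K)"
      using cardB by (intro power_increasing) auto
    also have "\<dots> = 8 ^ card K"
      by (simp add: power_mult)
    finally have "real (card (Pow ?B)) * ?x ^ card (insert i K) \<le> 8 ^ card K * ?x ^ card (insert i K)"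
      by (rule mult_right_mono) simp
    also have "\<dots> = ?x * (8 * ?x) ^ card K"
      using finK \<open>i \<notin> K\<close> by (simp add: power_mult_distrib)
    also have "\<dots> \<le> ?x * 1"
      using small by (intro mult_left_mono power_le_one) auto
    finally show "real (card (Pow ?B)) * ?x ^ card (insert i K) \<le> ?x" by simp
  qed (use partition_function_pos[OF assms(1), of \<beta>] in simp)
  finally show ?thesis .
qed

lemma sum_gibbs_weight_crowded_even_le:
  assumes "finite \<Lambda>" "\<beta> > 0" "i \<in> \<Lambda>" "even_config i" "8 * exp (- 2 * \<beta>) \<le> 1"
  shows "(\<Sum>\<omega> | \<omega> \<in> \<Omega>e \<Lambda> \<and> crowded \<omega> i. gibbs_weight \<Lambda> \<beta> \<omega>)
    \<le> 15 * exp (- 2 * \<beta>) * (\<Sum>\<omega>\<in>\<Omega>e \<Lambda>. gibbs_weight \<Lambda> \<beta> \<omega>)"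
proof -
  let ?A = "{\<omega>. \<omega> \<in> \<Omega>e \<Lambda> \<and> crowded \<omega> i}" and ?T = "Pow (neighbors i) - {{}}"
  let ?occ = "\<lambda>\<omega>. {j. j \<approx> i \<and> \<omega> j}" and ?Z = "\<Sum>\<omega>\<in>\<Omega>e \<Lambda>. gibbs_weight \<Lambda> \<beta> \<omega>"
  have "(\<Sum>\<omega>\<in>?A. gibbs_weight \<Lambda> \<beta> \<omega>) = (\<Sum>K\<in>?T. \<Sum>\<omega> | \<omega> \<in> ?A \<and> ?occ \<omega> = K. gibbs_weight \<Lambda> \<beta> \<omega>)"
    using finite_even_configs[OF assms(1)] finite_neighbors
    by (intro sum.group[symmetric]) (auto simp: crowded_def)
  also have "\<dots> \<le> (\<Sum>K\<in>?T. exp (- 2 * \<beta>) * ?Z)"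
  proof (rule sum_mono)
    fix K assume K: "K \<in> ?T"
    then have "{\<omega>. \<omega> \<in> ?A \<and> ?occ \<omega> = K} = {\<omega>. \<omega> \<in> \<Omega>e \<Lambda> \<and> \<omega> i \<and> ?occ \<omega> = K}"
      by (auto simp: crowded_def)
    then show "(\<Sum>\<omega> | \<omega> \<in> ?A \<and> ?occ \<omega> = K. gibbs_weight \<Lambda> \<beta> \<omega>) \<le> exp (- 2 * \<beta>) * ?Z"
      using sum_gibbs_weight_occupied_neighbors_le[of \<Lambda> \<beta> i K] assms K by simp
  qed
  also have "\<dots> = 15 * exp (- 2 * \<beta>) * ?Z"
    by (simp add: finite_neighbors card_Pow card_neighbors)
  finally show ?thesis .
qed

section \<open>The probability of an error\<close>

theorem proposition3p4:
  fixes \<Lambda> :: "site set"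
  assumes "finite \<Lambda>"
  shows "\<forall>\<beta>>0. \<forall>i\<in>\<Lambda>. \<exists>C::real. C \<le> 16 \<and>
    measure (gibbs_even \<Lambda> \<beta>) {\<omega> \<in> \<Omega>e \<Lambda>. i \<in> \<E> \<omega>} \<le> C * exp (- 2 * \<beta>)"
proof (intro allI impI ballI exI conjI)
  fix \<beta> :: real and i assume \<beta>: "\<beta> > 0" and i: "i \<in> \<Lambda>"
  let ?x = "exp (- 2 * \<beta>)" and ?w = "gibbs_weight \<Lambda> \<beta>"
  let ?A = "{\<omega> \<in> \<Omega>e \<Lambda>. i \<in> \<E> \<omega>}" and ?Z = "\<Sum>\<omega>\<in>\<Omega>e \<Lambda>. gibbs_weight \<Lambda> \<beta> \<omega>"
  show "measure (gibbs_even \<Lambda> \<beta>) ?A \<le> 16 * ?x"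
  proof (cases "8 * ?x \<le> 1")
    case False
    have "measure (gibbs_even \<Lambda> \<beta>) ?A \<le> 1"
      by (rule prob_space.prob_le_1[OF prob_space_gibbs_even[OF assms]])
    with False show ?thesis by linarith
  next
    case True
    have "?A = {\<omega>. \<omega> \<in> \<Omega>e \<Lambda> \<and> vacant \<omega> i} \<union> {\<omega>. \<omega> \<in> \<Omega>e \<Lambda> \<and> crowded \<omega> i}"
      by (auto simp: errors_iff)
    then have "(\<Sum>\<omega>\<in>?A. ?w \<omega>) = (\<Sum>\<omega> | \<omega> \<in> \<Omega>e \<Lambda> \<and> vacant \<omega> i. ?w \<omega>) + (\<Sum>\<omega> | \<omega> \<in> \<Omega>e \<Lambda> \<and> crowded \<omega> i. ?w \<omega>)"
      using finite_even_configs[OF assms]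
      by (simp only:) (intro sum.union_disjoint; auto simp: vacant_def crowded_def)
    also have "\<dots> \<le> ?x * ?Z + 15 * ?x * ?Z"
      using sum_gibbs_weight_vacant_le[OF assms \<beta> i] sum_gibbs_weight_crowded_odd_le[OF assms \<beta> i]
        sum_gibbs_weight_crowded_even_le[OF assms \<beta> i _ True]
      by (intro add_mono) blast+
    also have "\<dots> = 16 * ?x * ?Z" by simp
    finally show ?thesis
      using partition_function_pos[OF assms, of \<beta>]
      by (simp add: measure_gibbs_even[OF assms] divide_le_eq)
  qed
qed simp

end
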